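(* If a germ of surface is mapped biholomorphically onto a germ of the plane $\mathbb{C}^2$, then the geodesics of the surface through a point are given by plane curves whose centres of curvature at the common point lie on a cubic curve of the type $$E(x_0^2+y_0^2)=\alpha x_0^3+\beta x_0^2y_0+\gamma x_0y_0^2+\delta y_0^3,$$ with constants $\alpha,\beta,\gamma,\delta,E$ depending only on the point.
   Context: The plane is $\mathbb{C}^2$ with coordinates $(x,u)$. The surface is a germ of complex analytic surface with its (holomorphic, nondegenerate) metric, and its geodesics are those of the Levi-Civita connection. For a plane curve $u=u(x)$ through a point, with $v:=u'$ and $w:=u''\neq0$ at that point, the centre of curvature (in coordinates relative to the point) is $$x_0=-\frac{v(1+v^2)}{w},\qquad y_0=\frac{1+v^2}{w}.$$ The type of cubic is the one occurring for the equation $Eu''=Du'^3+Cu'^2+Bu'+A$, so that not all of $\alpha,\beta,\gamma,\delta,E$ are zero. *)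

theory Defs
  imports "HOL-Complex_Analysis.Complex_Analysis"
begin

text \<open>Holomorphy in two variables is complex Frechet differentiability at every point;
  it is only used on open sets. Maps into \<open>\<complex>\<^sup>2\<close> are holomorphic when their components are.\<close>

definition holomorphic2_on :: "(complex^2 \<Rightarrow> complex) \<Rightarrow> (complex^2) set \<Rightarrow> bool" where
  "holomorphic2_on f S \<longleftrightarrow>
     (\<forall>z\<in>S. \<exists>f'. (f has_derivative f') (at z) \<and> (\<forall>a h. f' (a *s h) = a * f' h))"

definition holomorphic_map2_on :: "(complex^2 \<Rightarrow> complex^2) \<Rightarrow> (complex^2) set \<Rightarrow> bool" where
  "holomorphic_map2_on F S \<longleftrightarrow> (\<forall>k. holomorphic2_on (\<lambda>z. F z $ k) S)"

definition partial2 :: "2 \<Rightarrow> (complex^2 \<Rightarrow> complex) \<Rightarrow> complex^2 \<Rightarrow> complex" where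
  "partial2 i f z = deriv (\<lambda>t. f (z + axis i t)) 0"

definition jacobian2 :: "(complex^2 \<Rightarrow> complex^2) \<Rightarrow> complex^2 \<Rightarrow> complex^2^2" where
  "jacobian2 F z = (\<chi> k i. partial2 i (\<lambda>y. F y $ k) z)"

text \<open>A chart is a pair of its domain and its coordinate map; the values of the coordinate map
  outside the domain are irrelevant.\<close>

type_synonym 'a chart2 = "'a set \<times> ('a \<Rightarrow> complex^2)"

definition chart2 :: "'a::topological_space chart2 \<Rightarrow> bool" where
  "chart2 = (\<lambda>(W, \<psi>). open W \<and> open (\<psi> ` W) \<and> homeomorphism W (\<psi> ` W) \<psi> (inv_into W \<psi>))"

definition transition2 :: "'a chart2 \<Rightarrow> 'a chart2 \<Rightarrow> complex^2 \<Rightarrow> complex^2" where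
  "transition2 = (\<lambda>(W, \<psi>) (W', \<psi>') z. \<psi>' (inv_into W \<psi> z))"

definition holomorphic_transition2 :: "'a chart2 \<Rightarrow> 'a chart2 \<Rightarrow> bool" where
  "holomorphic_transition2 \<xi> \<xi>' \<longleftrightarrow>
     holomorphic_map2_on (transition2 \<xi> \<xi>') (snd \<xi> ` (fst \<xi> \<inter> fst \<xi>'))"

definition complex_surface :: "'a::t2_space set \<Rightarrow> 'a chart2 set \<Rightarrow> bool" where
  "complex_surface M atl \<longleftrightarrow>
     (\<forall>\<xi>\<in>atl. chart2 \<xi>) \<and> (\<Union>\<xi>\<in>atl. fst \<xi>) = M \<and>
     (\<forall>\<xi>\<in>atl. \<forall>\<xi>'\<in>atl. holomorphic_transition2 \<xi> \<xi>')"

text \<open>A metric is given by its coefficient matrix in every chart, as a function of the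
  coordinates; the last clause is the transformation law of a covariant tensor of degree two.
  The metric is complex bilinear (not Hermitian).\<close>

type_synonym 'a metric2 = "'a chart2 \<Rightarrow> complex^2 \<Rightarrow> complex^2^2"

definition holomorphic_metric :: "'a chart2 set \<Rightarrow> 'a metric2 \<Rightarrow> bool" where
  "holomorphic_metric atl g \<longleftrightarrow>
     (\<forall>\<xi>\<in>atl.
        (\<forall>i j. holomorphic2_on (\<lambda>z. g \<xi> z $ i $ j) (snd \<xi> ` fst \<xi>)) \<and>
        (\<forall>z \<in> snd \<xi> ` fst \<xi>. transpose (g \<xi> z) = g \<xi> z \<and> det (g \<xi> z) \<noteq> 0)) \<and>
     (\<forall>\<xi>\<in>atl. \<forall>\<xi>'\<in>atl. \<forall>q \<in> fst \<xi> \<inter> fst \<xi>'.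
        let J = jacobian2 (transition2 \<xi> \<xi>') (snd \<xi> q)
        in g \<xi> (snd \<xi> q) = transpose J ** g \<xi>' (snd \<xi>' q) ** J)"

text \<open>\<open>christoffel G k i j\<close> is the coefficient \<open>\<Gamma>\<^sup>k\<^sub>i\<^sub>j\<close> of the Levi-Civita connection of the metric
  with coefficient matrix \<open>G\<close>.\<close>

definition christoffel :: "(complex^2 \<Rightarrow> complex^2^2) \<Rightarrow> 2 \<Rightarrow> 2 \<Rightarrow> 2 \<Rightarrow> complex^2 \<Rightarrow> complex" where
  "christoffel G k i j z =
     (\<Sum>l\<in>UNIV. matrix_inv (G z) $ k $ l *
        (partial2 i (\<lambda>y. G y $ j $ l) z + partial2 j (\<lambda>y. G y $ i $ l) z
          - partial2 l (\<lambda>y. G y $ i $ j) z)) / 2"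

text \<open>Geodesics are holomorphic curves with an affine complex parameter. Constant solutions of
  the geodesic equation are excluded; a nonconstant solution on a connected domain has nowhere
  vanishing velocity.\<close>

definition geodesic_on ::
  "'a::t2_space set \<Rightarrow> 'a chart2 set \<Rightarrow> 'a metric2 \<Rightarrow> complex set \<Rightarrow> (complex \<Rightarrow> 'a) \<Rightarrow> bool" where
  "geodesic_on M atl g T c \<longleftrightarrow>
     open T \<and> connected T \<and> continuous_on T c \<and> c ` T \<subseteq> M \<and>
     (\<forall>\<xi>\<in>atl.
        let x = (\<lambda>k t. snd \<xi> (c t) $ k); D = {t\<in>T. c t \<in> fst \<xi>}
        in (\<forall>k. x k holomorphic_on D) \<and>
           (\<forall>t\<in>D. (\<exists>k. deriv (x k) t \<noteq> 0) \<and>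
              (\<forall>k. deriv (deriv (x k)) t +
                 (\<Sum>i\<in>UNIV. \<Sum>j\<in>UNIV. christoffel (g \<xi>) k i j (snd \<xi> (c t)) *
                    deriv (x i) t * deriv (x j) t) = 0)))"

definition biholomorphic_onto_plane ::
  "'a::t2_space set \<Rightarrow> 'a chart2 set \<Rightarrow> ('a \<Rightarrow> complex^2) \<Rightarrow> 'a set \<Rightarrow> (complex^2) set \<Rightarrow> bool" where
  "biholomorphic_onto_plane M atl \<phi> U V \<longleftrightarrow>
     open U \<and> U \<subseteq> M \<and> open V \<and> homeomorphism U V \<phi> (inv_into U \<phi>) \<and>
     (\<forall>\<xi>\<in>atl. holomorphic_transition2 \<xi> (U, \<phi>) \<and> holomorphic_transition2 (U, \<phi>) \<xi>)"

text \<open>The plane has coordinates \<open>(x, u)\<close>, which are the components 1 and 2. Near the parameter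
  value \<open>t0\<close>, the parametrised plane curve \<open>C\<close> is the curve \<open>u = u(x)\<close>.\<close>

definition given_by_graph_at :: "(complex \<Rightarrow> complex^2) \<Rightarrow> complex \<Rightarrow> (complex \<Rightarrow> complex) \<Rightarrow> bool" where
  "given_by_graph_at C t0 u \<longleftrightarrow>
     u analytic_on {C t0 $ 1} \<and> (\<forall>\<^sub>F t in nhds t0. C t $ 2 = u (C t $ 1))"

text \<open>Centre of curvature of the curve \<open>u = u(x)\<close> at \<open>x = a\<close>, in coordinates relative to the point
  \<open>(a, u a)\<close>; meaningful only if the second derivative does not vanish at \<open>a\<close>.\<close>

definition curvature_centre :: "(complex \<Rightarrow> complex) \<Rightarrow> complex \<Rightarrow> complex \<times> complex" where
  "curvature_centre u a =
     (let v = deriv u a; w = deriv (deriv u) a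
      in (- (v * (1 + v\<^sup>2) / w), (1 + v\<^sup>2) / w))"

definition on_cubic ::
  "complex \<Rightarrow> complex \<Rightarrow> complex \<Rightarrow> complex \<Rightarrow> complex \<Rightarrow> complex \<times> complex \<Rightarrow> bool" where
  "on_cubic \<alpha> \<beta> \<gamma> \<delta> E = (\<lambda>(x0, y0).
     E * (x0\<^sup>2 + y0\<^sup>2) = \<alpha> * x0^3 + \<beta> * x0\<^sup>2 * y0 + \<gamma> * x0 * y0\<^sup>2 + \<delta> * y0^3)"

end

theory Submission
  imports Defs
begin

text \<open>In plane coordinates the geodesic equation still expresses the second derivatives of a
  geodesic as quadratic forms in its velocity, with coefficients depending only on the point: the
  chain rule adds to the Christoffel symbols only second derivatives of the coordinate change.
  Eliminating the parameter, a geodesic \<open>u = u(x)\<close> with slope \<open>v\<close> satisfies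
  \<open>u'' = A\<^sub>3 v\<^sup>3 + A\<^sub>2 v\<^sup>2 + A\<^sub>1 v + A\<^sub>0\<close>. Since \<open>x\<^sub>0 = - v y\<^sub>0\<close> and
  \<open>y\<^sub>0 u'' = 1 + v\<^sup>2\<close>, multiplying this equation by \<open>y\<^sub>0\<^sup>3\<close> gives the cubic, with \<open>E = 1\<close>.

  The chain rule to second order needs the partial derivatives of a holomorphic function to be
  holomorphic again; this follows by differentiating Cauchy's formula in one variable under the
  integral sign.\<close>

section \<open>Complex differentiability and partial derivatives in two variables\<close>

lemma norm_axis_eq: "norm (axis i x :: 'a::real_normed_vector ^ 'n) = norm x"
proof -
  have "(\<Sum>j\<in>UNIV. (norm ((axis i x :: 'a ^ 'n) $ j))\<^sup>2) = (\<Sum>j\<in>UNIV. if j = i then (norm x)\<^sup>2 else 0)"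
    by (intro sum.cong) (auto simp: axis_def)
  then show ?thesis by (simp add: norm_vec_def L2_set_def)
qed

lemma bounded_linear_axis: "bounded_linear (axis i :: 'a::real_normed_vector \<Rightarrow> 'a ^ 'n)"
proof
  show "axis i (x + y) = (axis i x + axis i y :: 'a ^ 'n)" for x y
    by (simp add: vec_eq_iff axis_def)
  show "axis i (r *\<^sub>R x) = (r *\<^sub>R axis i x :: 'a ^ 'n)" for r x
    by (simp add: vec_eq_iff axis_def)
  show "\<exists>K. \<forall>x. norm (axis i x :: 'a ^ 'n) \<le> norm x * K"
    by (rule exI[of _ 1]) (simp add: norm_axis_eq)
qed

lemma sum_axis: "(\<Sum>i\<in>UNIV. axis i (x $ i)) = (x :: 'a::comm_monoid_add ^ 'n)"
  by (simp add: vec_eq_iff axis_def if_distrib cong: if_cong)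

text \<open>Along the coordinate line in direction \<open>i\<close>, \<open>f\<close> has derivative
  \<open>f' (axis i 1)\<close>, which is therefore the partial derivative. Complex homogeneity and
  additivity then determine \<open>f'\<close> on every vector.\<close>

lemma has_derivative_partial2:
  assumes f: "(f has_derivative f') (at z)" and lin: "\<And>a h. f' (a *s h) = a * f' h"
  shows "f' h = (\<Sum>i\<in>UNIV. partial2 i f z * h $ i)"
proof -
  have *: "((\<lambda>t. f (z + axis i t)) has_field_derivative f' (axis i 1)) (at 0)" for i
  proof -
    have "((\<lambda>t. f (z + axis i t)) has_derivative (\<lambda>t. f' (axis i t))) (at 0)"
    proof (rule has_derivative_compose[where f="\<lambda>t. z + axis i t" and g=f])
      show "((\<lambda>t. z + axis i t) has_derivative axis i) (at 0)"
        by (rule has_derivative_eq_rhs[OF has_derivative_add[OF has_derivative_const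
            bounded_linear_imp_has_derivative[OF bounded_linear_axis]]]) simp
      show "(f has_derivative f') (at (z + axis i 0))"
        using f by (simp add: linear_0[OF bounded_linear.linear[OF bounded_linear_axis]])
    qed
    moreover have "(\<lambda>t. f' (axis i t)) = (*) (f' (axis i 1))"
    proof
      fix t :: complex
      have "axis i t = t *s (axis i 1 :: complex^2)" by (simp add: vec_eq_iff axis_def)
      then show "f' (axis i t) = f' (axis i 1) * t" by (simp only: lin mult.commute)
    qed
    ultimately show ?thesis unfolding has_field_derivative_def by simp
  qed
  then have p: "partial2 i f z = f' (axis i 1)" for i
    unfolding partial2_def by (rule DERIV_imp_deriv)
  have "h = (\<Sum>i\<in>UNIV. h $ i *s axis i 1)"
    by (simp add: vec_eq_iff axis_def if_distrib cong: if_cong)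
  then have "f' h = f' (\<Sum>i\<in>UNIV. h $ i *s axis i 1)" by simp
  also have "\<dots> = (\<Sum>i\<in>UNIV. f' (h $ i *s axis i 1))"
    using f by (intro linear_sum) (rule has_derivative_linear)
  finally show "f' h = (\<Sum>i\<in>UNIV. partial2 i f z * h $ i)"
    by (simp add: lin p mult.commute)
qed

lemma holomorphic2_onD:
  assumes "holomorphic2_on f S" "z \<in> S"
  shows "(f has_derivative (\<lambda>h. \<Sum>i\<in>UNIV. partial2 i f z * h $ i)) (at z)"
proof -
  obtain f' where f: "(f has_derivative f') (at z)" "\<And>a h. f' (a *s h) = a * f' h"
    using assms unfolding holomorphic2_on_def by blast
  have "f' = (\<lambda>h. \<Sum>i\<in>UNIV. partial2 i f z * h $ i)"
    by (rule ext) (rule has_derivative_partial2[OF f])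
  with f(1) show ?thesis by simp
qed

lemma holomorphic2_on_imp_continuous_on: "holomorphic2_on f S \<Longrightarrow> continuous_on S f"
  by (meson continuous_at_imp_continuous_on has_derivative_continuous holomorphic2_onD)

text \<open>Only the components of \<open>x\<close> are known to be differentiable. Writing
  \<open>x\<close> as the sum of its components placed on the axes yields a Frechet derivative of
  the vector-valued curve, to which the general chain rule applies.\<close>

lemma holomorphic2_on_compose_curve:
  fixes x :: "complex \<Rightarrow> complex^2"
  assumes f: "holomorphic2_on f S" "x t \<in> S"
    and x: "\<And>k. ((\<lambda>s. x s $ k) has_field_derivative d k) (at t)"
  shows "((\<lambda>s. f (x s)) has_field_derivative (\<Sum>k\<in>UNIV. partial2 k f (x t) * d k)) (at t)"
proof -
  have "((\<lambda>s. \<Sum>k\<in>UNIV. axis k (x s $ k)) has_derivative (\<lambda>h. \<Sum>k\<in>UNIV. axis k (d k * h))) (at t)"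
    by (intro has_derivative_sum bounded_linear.has_derivative[OF bounded_linear_axis])
      (use x in \<open>simp add: has_field_derivative_def\<close>)
  then have "(x has_derivative (\<lambda>h. \<Sum>k\<in>UNIV. axis k (d k * h))) (at t)"
    by (simp add: sum_axis)
  from has_derivative_compose[OF this holomorphic2_onD[OF f]]
  show ?thesis
    unfolding has_field_derivative_def
    by (rule has_derivative_eq_rhs)
      (simp add: fun_eq_iff axis_def if_distrib sum_distrib_left mult_ac cong: if_cong)
qed

lemma partial2_shift:
  assumes "holomorphic2_on f S" "z + axis i t \<in> S"
  shows "((\<lambda>t. f (z + axis i t)) has_field_derivative partial2 i f (z + axis i t)) (at t)"
proof -
  have "((\<lambda>s. (z + axis i s) $ k) has_field_derivative (if k = i then 1 else 0)) (at t)" for k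
    by (auto simp: axis_def intro!: derivative_eq_intros)
  from holomorphic2_on_compose_curve[OF assms this] show ?thesis
    by (simp add: if_distrib cong: if_cong)
qed

section \<open>Cauchy's formula and holomorphy of the partial derivatives\<close>

text \<open>This is Cauchy's formula for the first derivative of the slice of \<open>f\<close> in
  direction \<open>i\<close>. With the circle parametrised, \<open>z\<close> becomes a parameter of
  an integral over a fixed interval, ready for differentiation under the integral sign.\<close>

lemma partial2_Cauchy:
  assumes f: "holomorphic2_on f S" and r: "r > 0" "cball z r \<subseteq> S"
  shows "partial2 i f z =
    integral {0..1} (\<lambda>s. f (z + axis i (circlepath 0 r s)) / circlepath 0 r s)"
proof -
  let ?h = "\<lambda>t. f (z + axis i t)"
  have d: "(?h has_field_derivative partial2 i f (z + axis i t)) (at t)" if "t \<in> cball 0 r" for t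
    using that r by (intro partial2_shift[OF f]) (auto simp: norm_axis_eq dist_norm)
  have "continuous_on (cball 0 r) ?h"
    using d by (blast intro: DERIV_isCont continuous_at_imp_continuous_on)
  moreover have "?h holomorphic_on ball 0 r"
    unfolding holomorphic_on_def field_differentiable_def
    using d ball_subset_cball by (blast intro: has_field_derivative_at_within)
  ultimately have "(?h has_field_derivative (1 / (2 * of_real pi * \<i>) *
      contour_integral (circlepath 0 r) (\<lambda>u. ?h u / (u - 0)^2))) (at 0)"
    by (rule Cauchy_derivative_integral_circlepath) (use r in auto)
  then have "partial2 i f z = 1 / (2 * of_real pi * \<i>) *
      contour_integral (circlepath 0 r) (\<lambda>u. ?h u / u^2)"
    using DERIV_imp_deriv by (simp add: partial2_def)
  also have "\<dots> = integral {0..1} (\<lambda>s. 1 / (2 * of_real pi * \<i>) *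
      (?h (circlepath 0 r s) / (circlepath 0 r s)^2 * vector_derivative (circlepath 0 r) (at s)))"
    by (simp only: contour_integral_integral integral_mult_right)
  \<comment> \<open>On a circle about 0 the velocity is \<open>2 * pi * \<i>\<close> times the
    position, which cancels the constant in front and one of the two factors in the
    denominator.\<close>
  also have "\<dots> = integral {0..1} (\<lambda>s. ?h (circlepath 0 r s) / circlepath 0 r s)"
    unfolding vector_derivative_circlepath
    by (intro integral_cong) (use r in \<open>simp add: circlepath field_simps power2_eq_square\<close>)
  finally show ?thesis .
qed

lemma circlepath_0: "r > 0 \<Longrightarrow> circlepath 0 r s \<noteq> 0" "r > 0 \<Longrightarrow> norm (circlepath 0 r s) = r"
  by (simp_all add: circlepath norm_mult)

lemma continuous_on_circlepath: "continuous_on X (circlepath z r)"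
  by (rule continuous_at_imp_continuous_on)
    (blast intro: has_vector_derivative_continuous has_vector_derivative_circlepath)

lemma continuous_on_circlepath_snd: "continuous_on X (\<lambda>w. circlepath z r (snd w))"
  by (rule continuous_on_compose2[OF continuous_on_circlepath continuous_on_snd[OF continuous_on_id]])
    (rule subset_UNIV)

text \<open>The doubled radius leaves room for two displacements: from \<open>z0\<close> to
  \<open>z\<close>, and from \<open>z\<close> to a point of the circle about it.\<close>

lemma cball_shift_axis:
  assumes "z \<in> ball z0 r" "norm t \<le> r" "cball z0 (2 * r) \<subseteq> S"
  shows "z + axis i t \<in> S"
proof -
  have "dist z0 (z + axis i t) \<le> dist z0 z + norm (axis i t)"
    by (metis add_diff_cancel_left' dist_commute dist_norm dist_triangle)
  also have "\<dots> \<le> 2 * r" using assms by (simp add: norm_axis_eq)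
  finally show ?thesis using assms by auto
qed

text \<open>Joint continuity is what integrals with a parameter require. It is stated for any
  continuous \<open>F\<close> so as to serve both \<open>f\<close> and its partial
  derivatives.\<close>

lemma continuous_on_Cauchy_integrand:
  assumes F: "continuous_on S F" and r: "r > 0" "cball z0 (2 * r) \<subseteq> S"
  shows "continuous_on (ball z0 r \<times> {0..1}) (\<lambda>(z, s). F (z + axis i (circlepath 0 r s)))"
  unfolding case_prod_unfold
proof (rule continuous_on_compose2[OF F])
  show "continuous_on (ball z0 r \<times> {0..1}) (\<lambda>w. fst w + axis i (circlepath 0 r (snd w)))"
    by (intro continuous_on_add continuous_on_fst continuous_on_id
        bounded_linear.continuous_on[OF bounded_linear_axis] continuous_on_circlepath_snd)
  show "(\<lambda>w. fst w + axis i (circlepath 0 r (snd w))) ` (ball z0 r \<times> {0..1}) \<subseteq> S"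
    using r by (auto intro!: cball_shift_axis[OF _ _ r(2)] simp: circlepath_0)
qed

lemma partial2_Cauchy_ball:
  assumes f: "holomorphic2_on f S" and r: "r > 0" "cball z0 (2 * r) \<subseteq> S" and z: "z \<in> ball z0 r"
  shows "partial2 i f z =
    integral {0..1} (\<lambda>s. f (z + axis i (circlepath 0 r s)) / circlepath 0 r s)"
proof -
  have "cball z r \<subseteq> cball z0 (2 * r)"
    using z by (intro cball_subset_cball_iff[THEN iffD2]) (auto simp: dist_commute)
  then show ?thesis using partial2_Cauchy[OF f r(1)] r by blast
qed

text \<open>Complex differentiability at each point does not include continuity of the partial
  derivatives; Cauchy's integral depends continuously on its centre. The Leibniz rule below needs
  this for the derivative of the integrand.\<close>

lemma continuous_on_partial2:
  assumes f: "holomorphic2_on f S" and S: "open S"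
  shows "continuous_on S (partial2 i f)"
proof (rule continuous_at_imp_continuous_on, rule ballI)
  fix z0 assume "z0 \<in> S"
  then obtain e where e: "e > 0" "cball z0 e \<subseteq> S" using S open_contains_cball by blast
  define r where "r = e / 2"
  have r: "r > 0" "cball z0 (2 * r) \<subseteq> S" using e by (auto simp: r_def)
  have "continuous_on (ball z0 r \<times> {0..1})
      (\<lambda>(z, s). f (z + axis i (circlepath 0 r s)) / circlepath 0 r s)"
    using continuous_on_Cauchy_integrand[OF holomorphic2_on_imp_continuous_on[OF f] r]
    unfolding case_prod_unfold
    by (rule continuous_on_divide[OF _ continuous_on_circlepath_snd]) (simp add: circlepath_0 r)
  then have "continuous_on (ball z0 r)
      (\<lambda>z. integral {0..1} (\<lambda>s. f (z + axis i (circlepath 0 r s)) / circlepath 0 r s))"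
    using integral_continuous_on_param[of _ 0 "1::real"] by simp
  then have "continuous_on (ball z0 r) (partial2 i f)"
    by (rule continuous_on_eq) (simp add: partial2_Cauchy_ball[OF f r])
  then show "isCont (partial2 i f) z0"
    using r by (simp add: continuous_on_eq_continuous_at)
qed

text \<open>Cauchy's integral is differentiated under the integral sign with respect to its
  centre.\<close>

lemma holomorphic2_on_partial2:
  assumes f: "holomorphic2_on f S" and S: "open S"
  shows "holomorphic2_on (partial2 i f) S"
  unfolding holomorphic2_on_def
proof
  fix z0 assume "z0 \<in> S"
  then obtain e where e: "e > 0" "cball z0 e \<subseteq> S" using S open_contains_cball by blast
  define r where "r = e / 2"
  have r: "r > 0" "cball z0 (2 * r) \<subseteq> S" using e by (auto simp: r_def)
  define c where "c = circlepath 0 r"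
  have c: "c s \<noteq> 0" "norm (c s) = r" for s using r by (simp_all add: c_def circlepath_0)
  \<comment> \<open>The derivative of the integrand with respect to \<open>z\<close>, packaged as a
    bounded linear function because the Leibniz rule integrates derivatives of that type.\<close>
  define D where "D z s = (\<Sum>k\<in>UNIV. blinfun_mult_right (partial2 k f (z + axis i (c s)) / c s)
      o\<^sub>L Blinfun (\<lambda>h. h $ k))" for z s
  have D: "blinfun_apply (D z s) h = (\<Sum>k\<in>UNIV. partial2 k f (z + axis i (c s)) / c s * h $ k)" for z s h
    by (simp add: D_def sum_2 blinfun.add_left bounded_linear_Blinfun_apply[OF bounded_linear_vec_nth])
  have contc: "continuous_on X c" for X by (simp add: c_def continuous_on_circlepath)
  have contD: "continuous_on (ball z0 r \<times> {0..1}) (\<lambda>(z, s). D z s)"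
  proof -
    have "continuous_on (ball z0 r \<times> {0..1})
       (\<lambda>w. partial2 k f (fst w + axis i (c (snd w))) / c (snd w))" for k
      using continuous_on_Cauchy_integrand[OF continuous_on_partial2[OF f S] r, folded c_def]
      unfolding case_prod_unfold
      by (rule continuous_on_divide[OF _ continuous_on_circlepath_snd[of _ 0 r, folded c_def]])
        (simp add: c)
    then show ?thesis
      unfolding D_def case_prod_unfold
      by (intro continuous_on_sum continuous_on_const
          bounded_bilinear.continuous_on[OF bounded_bilinear_blinfun_compose]
          bounded_linear.continuous_on[OF bounded_linear_blinfun_mult_right])
  qed
  let ?I = "\<lambda>z. integral (cbox 0 1) (\<lambda>s. f (z + axis i (c s)) / c s)"
  have "(?I has_derivative integral (cbox 0 1) (D z0)) (at z0 within ball z0 r)"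
  proof (rule leibniz_rule)
    show "continuous_on (ball z0 r \<times> cbox 0 1) (\<lambda>(z, s). D z s)"
      using contD by simp
  next
    fix z s assume z: "z \<in> ball z0 r"
    have zS: "z + axis i (c s) \<in> S" by (rule cball_shift_axis[OF z _ r(2)]) (simp add: c)
    have "((\<lambda>z. f (z + axis i (c s))) has_derivative
        (\<lambda>h. \<Sum>k\<in>UNIV. partial2 k f (z + axis i (c s)) * h $ k)) (at z)"
      by (rule has_derivative_compose[where f="\<lambda>z. z + axis i (c s)" and f'="\<lambda>h. h",
            OF _ holomorphic2_onD[OF f zS]])
        (auto intro!: derivative_eq_intros)
    from bounded_linear.has_derivative[OF bounded_linear_divide[of "c s"] this]
    have "((\<lambda>z. f (z + axis i (c s)) / c s) has_derivative
        (\<lambda>h. (\<Sum>k\<in>UNIV. partial2 k f (z + axis i (c s)) * h $ k) / c s)) (at z)"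
      .
    moreover have "blinfun_apply (D z s) =
        (\<lambda>h. (\<Sum>k\<in>UNIV. partial2 k f (z + axis i (c s)) * h $ k) / c s)"
      by (auto simp: D sum_divide_distrib)
    ultimately show "((\<lambda>z. f (z + axis i (c s)) / c s) has_derivative blinfun_apply (D z s))
        (at z within ball z0 r)"
      by (simp add: has_derivative_at_withinI)
  next
    fix z assume z: "z \<in> ball z0 r"
    have "continuous_on {0..1} (\<lambda>s. f (z + axis i (c s)) / c s)"
      by (intro continuous_on_divide continuous_on_add continuous_on_const contc
          continuous_on_compose2[OF holomorphic2_on_imp_continuous_on[OF f]]
          bounded_linear.continuous_on[OF bounded_linear_axis])
        (auto simp: c intro!: cball_shift_axis[OF z _ r(2)])
    then show "(\<lambda>s. f (z + axis i (c s)) / c s) integrable_on cbox 0 1"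
      using integrable_continuous_real by simp
  qed (use r in simp_all)
  then have "(?I has_derivative integral {0..1} (D z0)) (at z0)"
    using r at_within_open[of z0 "ball z0 r"] by simp
  then have "(partial2 i f has_derivative integral {0..1} (D z0)) (at z0)"
    by (rule has_derivative_transform_within_open[of _ _ _ _ "ball z0 r"])
      (use r in \<open>auto simp: partial2_Cauchy_ball[OF f r] c_def\<close>)
  \<comment> \<open>A Frechet derivative is only real linear. Complex homogeneity holds for each
    \<open>D z0 s\<close> and passes to the integral, since evaluation at a vector commutes with
    integration.\<close>
  moreover have "blinfun_apply (integral {0..1} (D z0)) (a *s h) =
      a * blinfun_apply (integral {0..1} (D z0)) h" for a h
  proof -
    have "continuous_on {0..1} (\<lambda>s. (\<lambda>(z, s). D z s) (z0, s))"
      by (rule continuous_on_compose2[OF contD]) (use r in \<open>auto intro!: continuous_intros\<close>)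
    then have "D z0 integrable_on {0..1}" by (simp add: integrable_continuous_real)
    moreover have "blinfun_apply (D z0 s) (a *s h) = a * blinfun_apply (D z0 s) h" for s
      by (simp add: D sum_distrib_left mult.left_commute)
    ultimately show ?thesis
      by (simp only: blinfun_apply_integral integral_mult_right)
  qed
  ultimately show "\<exists>f'. (partial2 i f has_derivative f') (at z0) \<and> (\<forall>a h. f' (a *s h) = a * f' h)"
    by blast
qed

section \<open>The chain rule to second order\<close>

text \<open>The first-order formula holds on all of \<open>D\<close>, hence near \<open>t\<close>,
  so it can be differentiated once more by the product rule. Holomorphy of the partial derivatives
  of \<open>f\<close> is used here.\<close>

lemma deriv_compose_curve:
  fixes x :: "complex \<Rightarrow> complex^2"
  assumes f: "holomorphic2_on f S" and S: "open S" and D: "open D" "t \<in> D"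
    and x: "\<And>k. (\<lambda>s. x s $ k) holomorphic_on D" and xS: "\<And>s. s \<in> D \<Longrightarrow> x s \<in> S"
  shows "(\<lambda>s. f (x s)) holomorphic_on D"
    and "deriv (\<lambda>s. f (x s)) t = (\<Sum>i\<in>UNIV. partial2 i f (x t) * deriv (\<lambda>s. x s $ i) t)"
    and "deriv (deriv (\<lambda>s. f (x s))) t =
      (\<Sum>i\<in>UNIV. (\<Sum>j\<in>UNIV. partial2 j (partial2 i f) (x t) * deriv (\<lambda>s. x s $ j) t)
          * deriv (\<lambda>s. x s $ i) t + partial2 i f (x t) * deriv (deriv (\<lambda>s. x s $ i)) t)"
proof -
  have x': "((\<lambda>s. x s $ k) has_field_derivative deriv (\<lambda>s. x s $ k) s) (at s)" if "s \<in> D" for k s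
    using holomorphic_derivI[OF x D(1) that] .
  have x'': "(deriv (\<lambda>s. x s $ k) has_field_derivative deriv (deriv (\<lambda>s. x s $ k)) s) (at s)"
    if "s \<in> D" for k s
    using holomorphic_derivI[OF holomorphic_deriv[OF x D(1)] D(1) that] .
  have *: "((\<lambda>s. f (x s)) has_field_derivative
      (\<Sum>i\<in>UNIV. partial2 i f (x s) * deriv (\<lambda>s. x s $ i) s)) (at s)" if "s \<in> D" for s
    using holomorphic2_on_compose_curve[OF f xS[OF that] x'[OF that]] .
  then show "(\<lambda>s. f (x s)) holomorphic_on D"
    using D by (auto simp: holomorphic_on_open)
  show "deriv (\<lambda>s. f (x s)) t = (\<Sum>i\<in>UNIV. partial2 i f (x t) * deriv (\<lambda>s. x s $ i) t)"
    by (rule DERIV_imp_deriv[OF *[OF D(2)]])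
  have "((\<lambda>s. \<Sum>i\<in>UNIV. partial2 i f (x s) * deriv (\<lambda>s. x s $ i) s) has_field_derivative
      (\<Sum>i\<in>UNIV. (\<Sum>j\<in>UNIV. partial2 j (partial2 i f) (x t) * deriv (\<lambda>s. x s $ j) t)
          * deriv (\<lambda>s. x s $ i) t + deriv (deriv (\<lambda>s. x s $ i)) t * partial2 i f (x t))) (at t)"
    by (intro DERIV_sum DERIV_mult x''[OF D(2)]
        holomorphic2_on_compose_curve[OF holomorphic2_on_partial2[OF f S] xS[OF D(2)] x'[OF D(2)]])
  moreover have "\<forall>\<^sub>F s in nhds t.
      deriv (\<lambda>s. f (x s)) s = (\<Sum>i\<in>UNIV. partial2 i f (x s) * deriv (\<lambda>s. x s $ i) s)"
    using DERIV_imp_deriv[OF *] D by (auto simp: eventually_nhds)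
  then have "deriv (deriv (\<lambda>s. f (x s))) t =
      deriv (\<lambda>s. \<Sum>i\<in>UNIV. partial2 i f (x s) * deriv (\<lambda>s. x s $ i) s) t"
    by (rule deriv_cong_ev) (rule refl)
  ultimately show "deriv (deriv (\<lambda>s. f (x s))) t =
      (\<Sum>i\<in>UNIV. (\<Sum>j\<in>UNIV. partial2 j (partial2 i f) (x t) * deriv (\<lambda>s. x s $ j) t)
          * deriv (\<lambda>s. x s $ i) t + partial2 i f (x t) * deriv (deriv (\<lambda>s. x s $ i)) t)"
    by (simp only: DERIV_imp_deriv mult.commute[of "partial2 _ _ _" "deriv (deriv _) _"])
qed

section \<open>Parametrised plane curves as graphs\<close>

lemma deriv_graph:
  assumes X: "X holomorphic_on D" "open D" "t0 \<in> D" and u: "u analytic_on {X t0}"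
    and Y: "\<forall>\<^sub>F t in nhds t0. Y t = u (X t)"
  shows "deriv Y t0 = deriv u (X t0) * deriv X t0"
    and "deriv (deriv Y) t0 =
      deriv (deriv u) (X t0) * (deriv X t0)\<^sup>2 + deriv u (X t0) * deriv (deriv X) t0"
proof -
  obtain G where G: "open G" "X t0 \<in> G" "u holomorphic_on G"
    using u by (auto simp: analytic_at)
  define N where "N = {t \<in> D. X t \<in> G}"
  have "open N" unfolding N_def
    using continuous_open_preimage[OF holomorphic_on_imp_continuous_on[OF X(1)] X(2) G(1)]
    by (simp add: vimage_def Int_def)
  have tN: "t0 \<in> N" using X G by (simp add: N_def)
  have X': "(X has_field_derivative deriv X t) (at t)"
    and X'': "(deriv X has_field_derivative deriv (deriv X) t) (at t)"
    and u': "(u has_field_derivative deriv u (X t)) (at (X t))"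
    and u'': "(deriv u has_field_derivative deriv (deriv u) (X t)) (at (X t))"
    if "t \<in> N" for t
    using that X G holomorphic_deriv by (auto simp: N_def intro!: holomorphic_derivI)
  have uX: "((\<lambda>t. u (X t)) has_field_derivative deriv u (X t) * deriv X t) (at t)"
    if "t \<in> N" for t
    by (rule DERIV_chain2[OF u' X']) fact+
  have "\<forall>\<^sub>F t in nhds t0. t \<in> N" using \<open>open N\<close> tN by (simp add: eventually_nhds_in_open)
  \<comment> \<open>What holds near \<open>t0\<close> also holds near each nearby \<open>t\<close>.
    The first-derivative formula is thus valid in a neighbourhood of \<open>t0\<close> and may
    itself be differentiated.\<close>
  moreover have "\<forall>\<^sub>F t in nhds t0. \<forall>\<^sub>F s in nhds t. Y s = u (X s)"
    using Y by (simp add: eventually_eventually)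
  ultimately have ev: "\<forall>\<^sub>F t in nhds t0. deriv Y t = deriv u (X t) * deriv X t"
  proof eventually_elim
    case (elim t)
    then show ?case using deriv_cong_ev[OF elim(2) refl] DERIV_imp_deriv[OF uX] by simp
  qed
  then show "deriv Y t0 = deriv u (X t0) * deriv X t0"
    by (rule eventually_nhds_x_imp_x)
  have "((\<lambda>t. deriv u (X t) * deriv X t) has_field_derivative
      deriv (deriv u) (X t0) * deriv X t0 * deriv X t0 + deriv (deriv X) t0 * deriv u (X t0)) (at t0)"
    by (intro DERIV_mult DERIV_chain2[OF u'' X'] X'' tN)
  with deriv_cong_ev[OF ev refl] show "deriv (deriv Y) t0 =
      deriv (deriv u) (X t0) * (deriv X t0)\<^sup>2 + deriv u (X t0) * deriv (deriv X) t0"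
    by (simp add: DERIV_imp_deriv power2_eq_square mult.commute)
qed

text \<open>A nonzero derivative makes \<open>X\<close> injective near \<open>t0\<close> with open
  image and holomorphic inverse \<open>h\<close>; the function sought is
  \<open>Y \<circ> h\<close>.\<close>

lemma ex_graph:
  assumes X: "X holomorphic_on D" and Y: "Y holomorphic_on D" and D: "open D" "t0 \<in> D"
    and nz: "deriv X t0 \<noteq> 0"
  shows "\<exists>u. u analytic_on {X t0} \<and> (\<forall>\<^sub>F t in nhds t0. Y t = u (X t))"
proof -
  obtain r where r: "r > 0" "ball t0 r \<subseteq> D" "open (X ` ball t0 r)" "inj_on X (ball t0 r)"
    using has_complex_derivative_locally_invertible[OF X D(2,1) nz] .
  have Xr: "X holomorphic_on ball t0 r" using X r(2) by (rule holomorphic_on_subset)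
  obtain h where h: "h holomorphic_on X ` ball t0 r" "\<And>t. t \<in> ball t0 r \<Longrightarrow> h (X t) = t"
    using holomorphic_has_inverse[OF Xr open_ball r(4)] by metis
  have "(Y \<circ> h) holomorphic_on X ` ball t0 r"
    using Y r(2) h by (intro holomorphic_on_compose holomorphic_on_subset[OF Y]) auto
  then have "(Y \<circ> h) analytic_on {X t0}"
    using r by (auto simp: analytic_at)
  moreover have "\<forall>\<^sub>F t in nhds t0. Y t = (Y \<circ> h) (X t)"
    using r(1) h(2) eventually_nhds_in_open[of "ball t0 r" t0] by (auto elim: eventually_mono)
  ultimately show ?thesis by blast
qed

section \<open>The geodesic equation in plane coordinates\<close>

lemma open_homeomorphism_image:
  assumes "homeomorphism W V f h" "open V" "open A" "A \<subseteq> W"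
  shows "open (f ` A)"
  using homeomorphism_imp_open_map[OF assms(1) open_subset[OF assms(4,3)]] assms(2)
  by (simp add: openin_open_eq)

text \<open>A form with matrix \<open>B\<close> becomes, under the linear substitution
  \<open>K\<close>, the form with matrix \<open>transpose K ** B ** K\<close>. This carries the
  acceleration from chart velocities to plane velocities.\<close>

lemma quadratic_form_substitution:
  fixes B K :: "'n::finite \<Rightarrow> 'n \<Rightarrow> 'a::comm_ring_1"
  shows "(\<Sum>i\<in>UNIV. \<Sum>j\<in>UNIV. B i j * (\<Sum>a\<in>UNIV. K i a * y a) * (\<Sum>b\<in>UNIV. K j b * y b)) =
    (\<Sum>a\<in>UNIV. \<Sum>b\<in>UNIV. (\<Sum>i\<in>UNIV. \<Sum>j\<in>UNIV. B i j * K i a * K j b) * y a * y b)"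
    (is "?L = ?R")
proof -
  let ?T = "\<lambda>i j a b. B i j * K i a * K j b * y a * y b"
  have "B i j * (\<Sum>a\<in>UNIV. K i a * y a) * (\<Sum>b\<in>UNIV. K j b * y b) =
      (\<Sum>a\<in>UNIV. \<Sum>b\<in>UNIV. ?T i j a b)" for i j
    unfolding mult.assoc[of "B i j"] sum_product by (simp add: sum_distrib_left mult_ac)
  then have "?L = (\<Sum>i\<in>UNIV. \<Sum>j\<in>UNIV. \<Sum>a\<in>UNIV. \<Sum>b\<in>UNIV. ?T i j a b)" by simp
  also have "\<dots> = (\<Sum>i\<in>UNIV. \<Sum>a\<in>UNIV. \<Sum>j\<in>UNIV. \<Sum>b\<in>UNIV. ?T i j a b)"
    by (rule sum.cong[OF refl], rule sum.swap)
  also have "\<dots> = (\<Sum>a\<in>UNIV. \<Sum>i\<in>UNIV. \<Sum>j\<in>UNIV. \<Sum>b\<in>UNIV. ?T i j a b)"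
    by (rule sum.swap)
  also have "\<dots> = (\<Sum>a\<in>UNIV. \<Sum>i\<in>UNIV. \<Sum>b\<in>UNIV. \<Sum>j\<in>UNIV. ?T i j a b)"
    by (rule sum.cong[OF refl], rule sum.cong[OF refl], rule sum.swap)
  also have "\<dots> = (\<Sum>a\<in>UNIV. \<Sum>b\<in>UNIV. \<Sum>i\<in>UNIV. \<Sum>j\<in>UNIV. ?T i j a b)"
    by (rule sum.cong[OF refl], rule sum.swap)
  finally show ?thesis by (simp add: sum_distrib_right)
qed

text \<open>The quantifier over \<open>P\<close> comes first, so the same coefficients serve all
  geodesics through \<open>p\<close>. A single chart around \<open>p\<close> is fixed; the geodesic
  equation in it replaces the second derivatives that the chain rule for the transition
  \<open>F\<close> produces.\<close>

lemma geodesic_acceleration_quadratic: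
  fixes M U :: "'a::t2_space set" and \<phi> :: "'a \<Rightarrow> complex^2"
  assumes atl: "complex_surface M atl" and \<phi>: "biholomorphic_onto_plane M atl \<phi> U V" and p: "p \<in> U"
  shows "\<exists>P. \<forall>T c t0. geodesic_on M atl g T c \<longrightarrow> t0 \<in> T \<longrightarrow> c t0 = p \<longrightarrow>
    (\<exists>N. open N \<and> t0 \<in> N \<and> (\<forall>k. (\<lambda>t. \<phi> (c t) $ k) holomorphic_on N)) \<and>
    (\<exists>k. deriv (\<lambda>t. \<phi> (c t) $ k) t0 \<noteq> 0) \<and>
    (\<forall>k. deriv (deriv (\<lambda>t. \<phi> (c t) $ k)) t0 = (\<Sum>a\<in>UNIV. \<Sum>b\<in>UNIV.
      P k a b * deriv (\<lambda>t. \<phi> (c t) $ a) t0 * deriv (\<lambda>t. \<phi> (c t) $ b) t0))"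
proof -
  have U: "open U" "U \<subseteq> M" "open V" "homeomorphism U V \<phi> (inv_into U \<phi>)"
    using \<phi> by (auto simp: biholomorphic_onto_plane_def)
  obtain \<xi> where \<xi>: "\<xi> \<in> atl" "p \<in> fst \<xi>"
    using atl p U(2) by (auto simp: complex_surface_def)
  define W \<psi> where "W = fst \<xi>" and "\<psi> = snd \<xi>"
  have \<xi>_eq: "\<xi> = (W, \<psi>)" by (simp add: W_def \<psi>_def)
  have W: "open W" "open (\<psi> ` W)" "homeomorphism W (\<psi> ` W) \<psi> (inv_into W \<psi>)" "p \<in> W"
    using atl \<xi> by (auto simp: complex_surface_def chart2_def \<xi>_eq)
  define F H where "F = transition2 \<xi> (U, \<phi>)" and "H = transition2 (U, \<phi>) \<xi>"
  have F: "holomorphic2_on (\<lambda>z. F z $ k) (\<psi> ` (W \<inter> U))"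
    and H: "holomorphic2_on (\<lambda>z. H z $ k) (\<phi> ` (W \<inter> U))" for k
    using \<phi> \<xi> by (auto simp: biholomorphic_onto_plane_def holomorphic_transition2_def
        holomorphic_map2_on_def F_def H_def \<xi>_eq Int_commute)
  have FH: "F (\<psi> q) = \<phi> q" "H (\<phi> q) = \<psi> q" if "q \<in> W \<inter> U" for q
    using that homeomorphism_apply1[OF W(3)] homeomorphism_apply1[OF U(4)]
    by (auto simp: F_def H_def transition2_def \<xi>_eq)
  have op: "open (\<psi> ` (W \<inter> U))" "open (\<phi> ` (W \<inter> U))"
    using W U by (blast intro: open_homeomorphism_image open_Int)+
  \<comment> \<open>\<open>B\<close> expresses the plane acceleration through chart velocities;
    \<open>K\<close>, the Jacobian of the inverse transition, turns these into plane velocities and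
    \<open>B\<close> into \<open>P\<close>.\<close>
  define B where "B k i j = partial2 j (partial2 i (\<lambda>z. F z $ k)) (\<psi> p)
    - (\<Sum>l\<in>UNIV. partial2 l (\<lambda>z. F z $ k) (\<psi> p) * christoffel (g \<xi>) l i j (\<psi> p))" for k i j
  define K where "K i a = partial2 a (\<lambda>z. H z $ i) (\<phi> p)" for i a
  define P where "P k a b = (\<Sum>i\<in>UNIV. \<Sum>j\<in>UNIV. B k i j * K i a * K j b)" for k a b
  show ?thesis
  proof (rule exI[of _ P], intro allI impI, goal_cases)
    case (1 T c t0)
    note geo = 1
    have T: "open T" "continuous_on T c" using geo(1) unfolding geodesic_on_def by blast+
    have openD: "open {t \<in> T. c t \<in> A}" if "open A" for A
      using continuous_open_preimage[OF T(2,1) that] by (simp add: vimage_def Int_def)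
    define N where "N = {t \<in> T. c t \<in> W \<inter> U}"
    have N: "open N" "t0 \<in> N" using openD[of "W \<inter> U"] W U p geo by (auto simp: N_def)
    define x X where "x k t = \<psi> (c t) $ k" and "X k t = \<phi> (c t) $ k" for k t
    have "(\<forall>k. x k holomorphic_on {t \<in> T. c t \<in> W}) \<and> (\<forall>t\<in>{t \<in> T. c t \<in> W}. (\<exists>k. deriv (x k) t \<noteq> 0) \<and>
              (\<forall>k. deriv (deriv (x k)) t +
                 (\<Sum>i\<in>UNIV. \<Sum>j\<in>UNIV. christoffel (g \<xi>) k i j (\<psi> (c t)) *
                    deriv (x i) t * deriv (x j) t) = 0))"
      using geo(1) \<xi>(1) unfolding geodesic_on_def Let_def x_def W_def \<psi>_def by blast
    moreover have "t0 \<in> {t \<in> T. c t \<in> W}" using geo W by simp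
    ultimately have x: "\<And>k. x k holomorphic_on N" and nz: "\<exists>k. deriv (x k) t0 \<noteq> 0"
      and ode: "\<And>k. deriv (deriv (x k)) t0 = - (\<Sum>i\<in>UNIV. \<Sum>j\<in>UNIV.
        christoffel (g \<xi>) k i j (\<psi> p) * deriv (x i) t0 * deriv (x j) t0)"
      by (auto simp: N_def geo(3) eq_neg_iff_add_eq_0 intro: holomorphic_on_subset)
    have near: "\<forall>\<^sub>F t in nhds t0. t \<in> N" using N by (simp add: eventually_nhds_in_open)
    have "\<forall>\<^sub>F t in nhds t0. X k t = F (\<psi> (c t)) $ k" for k
      using near by eventually_elim (simp add: X_def N_def FH)
    from higher_deriv_cong_ev[OF this refl, of 2]
    have dX: "deriv (deriv (X k)) t0 = deriv (deriv (\<lambda>t. F (\<psi> (c t)) $ k)) t0" for k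
      by (simp add: eval_nat_numeral)
    have "\<forall>\<^sub>F t in nhds t0. x k t = H (\<phi> (c t)) $ k" for k
      using near by eventually_elim (simp add: x_def N_def FH)
    then have dx: "deriv (x k) t0 = deriv (\<lambda>t. H (\<phi> (c t)) $ k) t0" for k
      by (rule deriv_cong_ev) (rule refl)
    have xN: "\<psi> (c t) \<in> \<psi> ` (W \<inter> U)" "\<phi> (c t) \<in> \<phi> ` (W \<inter> U)" if "t \<in> N" for t
      using that by (simp_all add: N_def)
    note comp = deriv_compose_curve[OF F op(1) N, of "\<lambda>t. \<psi> (c t)", folded x_def, OF x xN(1)]
    have holX: "X k holomorphic_on N" for k
    proof -
      have "(\<lambda>t. F (\<psi> (c t)) $ k) holomorphic_on N" by (rule comp(1))
      then show ?thesis
        by (rule holomorphic_transform) (simp add: N_def X_def FH)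
    qed
    \<comment> \<open>The chain rule for \<open>H\<close> gives chart velocities from plane
      velocities directly, without inverting the Jacobian of \<open>F\<close>. It also shows below
      that the plane velocity cannot vanish.\<close>
    have x': "deriv (x i) t0 = (\<Sum>a\<in>UNIV. K i a * deriv (X a) t0)" for i
      using deriv_compose_curve(2)[OF H op(2) N, of "\<lambda>t. \<phi> (c t)", folded X_def, OF holX xN(2)]
      by (simp add: dx K_def geo(3))
    have X'': "deriv (deriv (X k)) t0 = (\<Sum>i\<in>UNIV. \<Sum>j\<in>UNIV. B k i j * deriv (x i) t0 * deriv (x j) t0)" for k
    proof -
      have "deriv (deriv (X k)) t0 =
        (\<Sum>i\<in>UNIV. (\<Sum>j\<in>UNIV. partial2 j (partial2 i (\<lambda>z. F z $ k)) (\<psi> p) * deriv (x j) t0)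
          * deriv (x i) t0 + partial2 i (\<lambda>z. F z $ k) (\<psi> p) * deriv (deriv (x i)) t0)"
        using comp(3)[of k] by (simp add: dX geo(3))
      then show ?thesis unfolding ode B_def by (simp add: sum_2 algebra_simps)
    qed
    have "\<exists>k. deriv (X k) t0 \<noteq> 0" 
    proof (rule ccontr)
      assume "\<nexists>k. deriv (X k) t0 \<noteq> 0"
      then have "deriv (x i) t0 = 0" for i by (simp add: x')
      with nz show False by blast
    qed
    moreover have "deriv (deriv (X k)) t0 =
        (\<Sum>a\<in>UNIV. \<Sum>b\<in>UNIV. P k a b * deriv (X a) t0 * deriv (X b) t0)" for k
      unfolding X'' x' P_def by (rule quadratic_form_substitution)
    ultimately show ?case using N holX unfolding X_def by blast
  qed
qed

section \<open>Elimination of the parameter and the cubic of centres\<close>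

theorem proposition3p6:
  fixes M U :: "'a::t2_space set" and atl :: "'a chart2 set" and g :: "'a metric2"
    and \<phi> :: "'a \<Rightarrow> complex^2" and V :: "(complex^2) set" and p :: 'a
  assumes "complex_surface M atl"
    and "holomorphic_metric atl g"
    and "biholomorphic_onto_plane M atl \<phi> U V"
    and "p \<in> U"
  shows "\<exists>\<alpha> \<beta> \<gamma> \<delta> E :: complex.
    \<not> (\<alpha> = 0 \<and> \<beta> = 0 \<and> \<gamma> = 0 \<and> \<delta> = 0 \<and> E = 0) \<and>
    (\<forall>T c t0. geodesic_on M atl g T c \<longrightarrow> t0 \<in> T \<longrightarrow> c t0 = p \<longrightarrow>
       (deriv (\<lambda>t. \<phi> (c t) $ 1) t0 \<noteq> 0 \<longrightarrow> (\<exists>u. given_by_graph_at (\<phi> \<circ> c) t0 u)) \<and>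
       (\<forall>u. given_by_graph_at (\<phi> \<circ> c) t0 u \<longrightarrow> deriv (deriv u) (\<phi> p $ 1) \<noteq> 0 \<longrightarrow>
          on_cubic \<alpha> \<beta> \<gamma> \<delta> E (curvature_centre u (\<phi> p $ 1))))"
proof -
  obtain P where P: "\<forall>T c t0. geodesic_on M atl g T c \<longrightarrow> t0 \<in> T \<longrightarrow> c t0 = p \<longrightarrow>
    (\<exists>N. open N \<and> t0 \<in> N \<and> (\<forall>k. (\<lambda>t. \<phi> (c t) $ k) holomorphic_on N)) \<and>
    (\<exists>k. deriv (\<lambda>t. \<phi> (c t) $ k) t0 \<noteq> 0) \<and>
    (\<forall>k. deriv (deriv (\<lambda>t. \<phi> (c t) $ k)) t0 = (\<Sum>a\<in>UNIV. \<Sum>b\<in>UNIV.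
      P k a b * deriv (\<lambda>t. \<phi> (c t) $ a) t0 * deriv (\<lambda>t. \<phi> (c t) $ b) t0))"
    using geodesic_acceleration_quadratic[OF assms(1,3,4), where g = g] by (rule exE)
  \<comment> \<open>For a plane velocity \<open>(m, v * m)\<close>, these are the coefficients of
    the powers of \<open>v\<close> in the second acceleration component minus \<open>v\<close> times
    the first, divided by \<open>m\<^sup>2\<close>.\<close>
  define A\<^sub>0 A\<^sub>1 A\<^sub>2 A\<^sub>3 where "A\<^sub>0 = P 2 1 1" and "A\<^sub>1 = P 2 1 2 + P 2 2 1 - P 1 1 1"
    and "A\<^sub>2 = P 2 2 2 - P 1 1 2 - P 1 2 1" and "A\<^sub>3 = - P 1 2 2"
  have graph: "\<exists>u. given_by_graph_at (\<phi> \<circ> c) t0 u"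
    if c: "geodesic_on M atl g T c" "t0 \<in> T" "c t0 = p" and nz: "deriv (\<lambda>t. \<phi> (c t) $ 1) t0 \<noteq> 0"
    for T c t0
  proof -
    obtain N where N: "open N" "t0 \<in> N" "\<And>k. (\<lambda>t. \<phi> (c t) $ k) holomorphic_on N"
      using P[rule_format, OF c] by blast
    show ?thesis
      using ex_graph[OF N(3)[of 1] N(3)[of 2] N(1,2) nz] by (simp add: given_by_graph_at_def)
  qed
  \<comment> \<open>The signs alternate because the abscissa of the centre is \<open>- v\<close>
    times its ordinate. Taking \<open>E\<close> to be 1 ensures that not all constants
    vanish.\<close>
  have cubic: "on_cubic (- A\<^sub>3) A\<^sub>2 (- A\<^sub>1) A\<^sub>0 1 (curvature_centre u (\<phi> p $ 1))"
    if c: "geodesic_on M atl g T c" "t0 \<in> T" "c t0 = p" and u: "given_by_graph_at (\<phi> \<circ> c) t0 u"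
      and w0: "deriv (deriv u) (\<phi> p $ 1) \<noteq> 0" for T c t0 u
  proof -
    define X where "X k t = \<phi> (c t) $ k" for k t
    define v w where "v = deriv u (\<phi> p $ 1)" and "w = deriv (deriv u) (\<phi> p $ 1)"
    obtain N where N: "open N" "t0 \<in> N" "\<And>k. X k holomorphic_on N"
      and nz: "\<exists>k. deriv (X k) t0 \<noteq> 0"
      and X'': "\<And>k. deriv (deriv (X k)) t0 =
        (\<Sum>a\<in>UNIV. \<Sum>b\<in>UNIV. P k a b * deriv (X a) t0 * deriv (X b) t0)"
      using P[rule_format, OF c, folded X_def] by blast
    have X1: "X 1 t0 = \<phi> p $ 1" using c by (simp add: X_def)
    have u': "u analytic_on {X 1 t0}" "\<forall>\<^sub>F t in nhds t0. X 2 t = u (X 1 t)"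
      using u by (simp_all add: given_by_graph_at_def X_def)
    note d = deriv_graph[OF N(3,1,2) u', unfolded X1, folded v_def w_def]
    define m where "m = deriv (X 1) t0"
    \<comment> \<open>Along a graph the second velocity component is \<open>v * m\<close>, so
      \<open>m = 0\<close> would make the whole velocity vanish.\<close>
    have "m \<noteq> 0"
      using nz d(1) by (auto simp: m_def) (metis exhaust_2 mult_zero_right)
    have "w * m\<^sup>2 = deriv (deriv (X 2)) t0 - v * deriv (deriv (X 1)) t0"
      using d(2) by (simp add: m_def)
    also have "\<dots> = (A\<^sub>3 * v^3 + A\<^sub>2 * v\<^sup>2 + A\<^sub>1 * v + A\<^sub>0) * m\<^sup>2"
      unfolding X'' sum_2 d(1) m_def[symmetric]
      by (simp add: A\<^sub>0_def A\<^sub>1_def A\<^sub>2_def A\<^sub>3_def algebra_simps power2_eq_square power3_eq_cube)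
    finally have w: "w = A\<^sub>3 * v^3 + A\<^sub>2 * v\<^sup>2 + A\<^sub>1 * v + A\<^sub>0"
      using \<open>m \<noteq> 0\<close> by simp
    define y where "y = (1 + v\<^sup>2) / w"
    have yw: "y * w = 1 + v\<^sup>2" using w0 by (simp add: y_def w_def)
    \<comment> \<open>Here \<open>y\<close> is the ordinate and \<open>- (v * y)\<close> the
      abscissa of the centre. Their squares add up to \<open>y\<^sup>2 * (1 + v\<^sup>2)\<close>,
      that is \<open>y^3 * w\<close>, and the cubic polynomial for \<open>w\<close> is then
      inserted.\<close>
    have "(- (v * y))\<^sup>2 + y\<^sup>2 = y\<^sup>2 * (y * w)"
      unfolding yw by (simp add: algebra_simps power2_eq_square)
    also have "\<dots> = - A\<^sub>3 * (- (v * y))^3 + A\<^sub>2 * (- (v * y))\<^sup>2 * y + - A\<^sub>1 * (- (v * y)) * y\<^sup>2 + A\<^sub>0 * y^3"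
      unfolding w by (simp add: algebra_simps power2_eq_square power3_eq_cube)
    finally show ?thesis
      by (simp add: on_cubic_def curvature_centre_def Let_def y_def v_def w_def)
  qed
  show ?thesis
    by (intro exI[of _ "- A\<^sub>3"] exI[of _ "A\<^sub>2"] exI[of _ "- A\<^sub>1"] exI[of _ "A\<^sub>0"] exI[of _ 1])
      (use graph cubic in auto)
qed

end
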